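(* For all positive integers $k,\ell,n$, \[ (-1)^{\ell-1}\left(\sum_{j=-(\ell-1)}^{\ell} (-1)^j\, b_k\!\left(n-\tfrac{j(3j-1)}{2}\right)-\frac{1+(-1)^{[n \equiv 0 \pmod k]+1}}{2}\cdot \frac{n}{k} \right)=\sum_{j=1}^{\lfloor n/k\rfloor}j\,M_\ell(n-kj). \]
   Context: A partition of $n$ is a weakly decreasing finite sequence of positive integers summing to $n$ (the empty partition for $n=0$). $b_k(n)$ (for $n\ge1$) is the sum, over all partitions $\lambda$ of $n$, of the sum of the distinct part values of $\lambda$ that appear at least $k$ times in $\lambda$; $b_k(m)=0$ for $m\le 0$. $M_\ell(n)$ is the number of partitions of $n$ in which $\ell$ is the least positive integer that is not a part, and there are more parts greater than $\ell$ than there are parts less than $\ell$. $[P]$ is the Iverson bracket: $1$ if $P$ holds, $0$ otherwise (so the factor $\frac{1+(-1)^{[n\equiv0 \pmod k]+1}}{2}$ equals $1$ if $k\mid n$ and $0$ otherwise). *)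

theory Defs
  imports Complex_Main
begin

definition partitions_of :: "nat \<Rightarrow> nat list set" where
  "partitions_of n = {xs. sorted_wrt (\<ge>) xs \<and> (\<forall>x\<in>set xs. 0 < x) \<and> sum_list xs = n}"

lemma finite_partitions_of: "finite (partitions_of n)"
proof -
  have len: "length xs \<le> sum_list xs" if "\<forall>x\<in>set xs. 0 < x" for xs :: "nat list"
    using that by (induction xs) auto
  have "partitions_of n \<subseteq> {xs. set xs \<subseteq> {..n} \<and> length xs \<le> n}"
    using len by (auto simp: partitions_of_def dest: member_le_sum_list)
  then show ?thesis
    by (rule finite_subset) (simp add: finite_lists_length_le)
qed

text \<open>Each part value occurring at least \<open>k\<close> times is counted once per partition,
  however often it occurs. The argument is an integer because the recurrence evaluates this
  function at shifted, possibly negative, arguments.\<close>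

definition b_fun :: "nat \<Rightarrow> int \<Rightarrow> nat" where
  "b_fun k m =
     (if m \<le> 0 then 0
      else \<Sum>xs\<in>partitions_of (nat m). \<Sum>i | i \<in> set xs \<and> k \<le> count_list xs i. i)"

text \<open>The numbers of parts greater and less than \<open>l\<close> are counted with multiplicity.\<close>

definition M_fun :: "nat \<Rightarrow> nat \<Rightarrow> nat" where
  "M_fun l n =
     card {xs \<in> partitions_of n.
             (LEAST m. 0 < m \<and> m \<notin> set xs) = l \<and>
             length (filter (\<lambda>x. l < x) xs) > length (filter (\<lambda>x. x < l) xs)}"

end

theory Submission
  imports Defs "HOL-Computational_Algebra.Formal_Power_Series" "HOL-Library.Multiset"
begin

text \<open>
  All generating functions are formal power series in \<open>q = fps_X\<close>; write \<open>(q)\<^sub>n\<close> for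
  \<open>\<Prod>i=1..n. 1 - q ^ i\<close> and \<open>P\<close> for the generating function of all partitions. Since
  \<open>b\<^sub>k\<close> has generating function \<open>(\<Sum>i. i q ^ (k i)) P\<close>, the claim is the convolution of
  \<open>\<Sum>i. i q ^ (k i)\<close> with the truncated pentagonal number theorem of Andrews and Merca, which
  expresses a partial sum of the pentagonal series times \<open>P\<close> as \<open>1 \<plusminus> \<Sum>n. M\<^sub>l(n) q ^ n\<close>.

  That theorem follows by induction on \<open>l\<close>. Cutting a partition at \<open>l\<close> shows that \<open>M\<^sub>l\<close> has
  generating function \<open>S\<^sub>l = \<Sum>B. z(l-1,B) q ^ ((l+1)(B+1)) / (q)\<^bsub>B+1\<^esub>\<close>, where \<open>z(k,B)\<close>, a shifted
  Gaussian binomial coefficient, enumerates the partitions into at most \<open>B\<close> parts whose set of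
  parts is \<open>{1..k}\<close>. The recurrence \<open>z(k,B+1) = q ^ k (z(k,B) + z(k-1,B))\<close> makes
  \<open>q ^ k (S\<^sub>k + S\<^bsub>k+1\<^esub>)\<close> telescope up to a factor: it is \<open>\<Sum>B. w(B+1) - q ^ (2k+1) w(B)\<close> with
  \<open>w(B) = z(k,B) q ^ ((k+1)B) / (q)\<^bsub>B\<^esub>\<close>, and summing \<open>w\<close> gives a power of \<open>q\<close> times \<open>P\<close>.
\<close>

unbundle fps_syntax

section \<open>Partitions as multisets and their generating functions\<close>

text \<open>Multisets make removing, merging and separating parts plain algebra, with no order to
  maintain.\<close>

definition pos_mset :: "nat multiset set" where
  "pos_mset = {M. 0 \<notin># M}"

text \<open>An infinite fibre would get coefficient 0; subsets of \<open>pos_mset\<close> have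
  finite fibres, whence the side conditions of several rules below. Real coefficients allow
  subtraction and cancellation of nonzero factors.\<close>

definition genfun :: "nat multiset set \<Rightarrow> real fps" where
  "genfun A = Abs_fps (\<lambda>n. real (card {M \<in> A. sum_mset M = n}))"

lemma genfun_nth: "genfun A $ n = real (card {M \<in> A. sum_mset M = n})"
  by (simp add: genfun_def)

lemma inj_on_mset_partitions: "inj_on mset (partitions_of n)"
proof (rule inj_onI)
  fix xs ys assume "xs \<in> partitions_of n" "ys \<in> partitions_of n" "mset xs = mset ys"
  then have "sorted (rev xs)" "sorted (rev ys)" "mset (rev xs) = mset (rev ys)"
    by (simp_all add: partitions_of_def sorted_wrt_rev)
  then show "xs = ys"
    by (metis properties_for_sort rev_rev_ident)
qed

lemma mset_partitions_of: "mset ` partitions_of n = {M \<in> pos_mset. sum_mset M = n}"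
proof (intro equalityI subsetI)
  fix M assume "M \<in> {M \<in> pos_mset. sum_mset M = n}"
  then have M: "0 \<notin># M" "sum_mset M = n" by (auto simp: pos_mset_def)
  have "sum_list (sorted_list_of_multiset M) = n"
    using M by (metis mset_sorted_list_of_multiset sum_mset_sum_list)
  moreover have "sorted (sorted_list_of_multiset M)"
    by simp
  ultimately have "rev (sorted_list_of_multiset M) \<in> partitions_of n"
    using M by (auto simp: partitions_of_def sorted_wrt_rev intro!: gr0I)
  moreover have "mset (rev (sorted_list_of_multiset M)) = M" by simp
  ultimately show "M \<in> mset ` partitions_of n" by (metis imageI)
qed (auto simp: partitions_of_def pos_mset_def sum_mset_sum_list)

text \<open>A weakly decreasing list is determined by its multiset, so \<open>mset\<close> is a
  bijection. This carries \<open>b_fun\<close> and \<open>M_fun\<close> over to multisets.\<close>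

lemma card_partitions_of:
  assumes "\<And>xs. xs \<in> partitions_of n \<Longrightarrow> P xs \<longleftrightarrow> Q (mset xs)"
  shows "card {xs \<in> partitions_of n. P xs} = card {M \<in> pos_mset. sum_mset M = n \<and> Q M}"
proof (rule bij_betw_same_card[of mset])
  have "mset ` {xs \<in> partitions_of n. P xs} = {M \<in> mset ` partitions_of n. Q M}"
    using assms by auto
  then show "bij_betw mset {xs \<in> partitions_of n. P xs} {M \<in> pos_mset. sum_mset M = n \<and> Q M}"
    unfolding bij_betw_def mset_partitions_of
    by (auto intro: inj_on_subset[OF inj_on_mset_partitions])
qed

lemma finite_pos_mset: "A \<subseteq> pos_mset \<Longrightarrow> finite {M \<in> A. sum_mset M = n}"
  by (rule finite_subset[OF _ finite_imageI[OF finite_partitions_of], of _ mset n])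
     (auto simp: mset_partitions_of)

lemma genfun_Un:
  assumes "A \<subseteq> pos_mset" "B \<subseteq> pos_mset" "A \<inter> B = {}"
  shows "genfun (A \<union> B) = genfun A + genfun B"
proof (rule fps_ext)
  fix n
  have "{M \<in> A \<union> B. sum_mset M = n} = {M \<in> A. sum_mset M = n} \<union> {M \<in> B. sum_mset M = n}"
    by auto
  moreover have "card \<dots> = card {M \<in> A. sum_mset M = n} + card {M \<in> B. sum_mset M = n}"
    using assms by (intro card_Un_disjoint finite_pos_mset) auto
  ultimately show "genfun (A \<union> B) $ n = (genfun A + genfun B) $ n"
    by (simp add: genfun_nth)
qed

lemma genfun_image:
  assumes "inj_on f A" "\<And>M. M \<in> A \<Longrightarrow> sum_mset (f M) = c + sum_mset M"
  shows "genfun (f ` A) = fps_X ^ c * genfun A"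
proof (rule fps_ext)
  fix n
  have "{M \<in> f ` A. sum_mset M = n} = f ` {M \<in> A. c + sum_mset M = n}"
    using assms(2) by auto
  moreover have "inj_on f {M \<in> A. c + sum_mset M = n}"
    using assms(1) by (rule inj_on_subset) auto
  ultimately have "card {M \<in> f ` A. sum_mset M = n} = card {M \<in> A. c + sum_mset M = n}"
    by (simp add: card_image)
  moreover have "{M \<in> A. c + sum_mset M = n} = (if n < c then {} else {M \<in> A. sum_mset M = n - c})"
    by auto
  ultimately show "genfun (f ` A) $ n = (fps_X ^ c * genfun A) $ n"
    by (simp add: genfun_nth fps_X_power_mult_nth)
qed

lemma genfun_add_mset: "genfun (add_mset c ` A) = fps_X ^ c * genfun A"
  by (rule genfun_image) (auto simp: inj_on_def)

lemma genfun_empty: "genfun {} = 0"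
  by (rule fps_ext) (simp add: genfun_nth)

lemma genfun_unit: "genfun {{#}} = 1"
proof (rule fps_ext)
  fix n :: nat
  have "{M \<in> {{#}}. sum_mset M = n} = (if n = 0 then {{#}} else {})" by auto
  then show "genfun {{#}} $ n = 1 $ n" by (simp add: genfun_nth)
qed

text \<open>\<open>Q\<close> tells the parts of \<open>M\<close> from those of \<open>N\<close>, so
  both are recovered from \<open>M + N\<close> by filtering. Hence addition is injective and the
  coefficients convolve.\<close>

lemma genfun_plus:
  assumes "A \<subseteq> pos_mset" "B \<subseteq> pos_mset"
    and A: "\<And>M x. M \<in> A \<Longrightarrow> x \<in># M \<Longrightarrow> Q x"
    and B: "\<And>M x. M \<in> B \<Longrightarrow> x \<in># M \<Longrightarrow> \<not> Q x"
  shows "genfun ((\<lambda>(M, N). M + N) ` (A \<times> B)) = genfun A * genfun B"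
proof (rule fps_ext)
  fix n
  let ?A = "\<lambda>i. {M \<in> A. sum_mset M = i}" and ?B = "\<lambda>i. {M \<in> B. sum_mset M = i}"
  have filterA: "filter_mset Q (M + N) = M" and filterB: "filter_mset (\<lambda>x. \<not> Q x) (M + N) = N"
    if "M \<in> A" "N \<in> B" for M N
  proof -
    have "filter_mset Q M = M" "filter_mset Q N = {#}"
      "filter_mset (\<lambda>x. \<not> Q x) M = {#}" "filter_mset (\<lambda>x. \<not> Q x) N = N"
      using that A B by (auto simp: filter_mset_eq_conv)
    then show "filter_mset Q (M + N) = M" "filter_mset (\<lambda>x. \<not> Q x) (M + N) = N"
      by simp_all
  qed
  have inj: "inj_on (\<lambda>(i, M, N). M + N) (SIGMA i:{0..n}. ?A i \<times> ?B (n - i))"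
  proof (rule inj_onI, clarsimp)
    fix M N M' N' assume "M \<in> A" "N \<in> B" "M' \<in> A" "N' \<in> B" "M + N = M' + N'"
    then show "sum_mset M = sum_mset M' \<and> M = M' \<and> N = N'"
      using filterA filterB by metis
  qed
  have "{M \<in> (\<lambda>(M, N). M + N) ` (A \<times> B). sum_mset M = n}
      = (\<lambda>(i, M, N). M + N) ` (SIGMA i:{0..n}. ?A i \<times> ?B (n - i))"
    by (force simp: image_iff)
  then have "card {M \<in> (\<lambda>(M, N). M + N) ` (A \<times> B). sum_mset M = n}
      = (\<Sum>i=0..n. card (?A i) * card (?B (n - i)))"
    using assms(1,2)
    by (simp add: card_image[OF inj] card_SigmaI finite_pos_mset card_cartesian_product)
  then show "genfun ((\<lambda>(M, N). M + N) ` (A \<times> B)) $ n = (genfun A * genfun B) $ n"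
    by (simp add: genfun_nth fps_mult_nth)
qed

text \<open>Only values of \<open>s\<close> up to \<open>n\<close> occur on partitions of
  \<open>n\<close>. Infinite sums of series are thus avoided: they are read coefficientwise with a
  large enough bound \<open>N\<close>.\<close>

lemma genfun_nth_sum:
  assumes "A \<subseteq> pos_mset" "\<And>M. M \<in> A \<Longrightarrow> s M \<le> sum_mset M" "n < N"
  shows "genfun A $ n = (\<Sum>B<N. genfun {M \<in> A. s M = B}) $ n"
proof -
  have "{M \<in> A. sum_mset M = n} = (\<Union>B<N. {M \<in> {M \<in> A. s M = B}. sum_mset M = n})"
    using assms(2,3) by force
  moreover have "card \<dots> = (\<Sum>B<N. card {M \<in> {M \<in> A. s M = B}. sum_mset M = n})"
    using assms(1) by (intro card_UN_disjoint ballI finite_pos_mset) auto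
  ultimately show ?thesis
    by (simp add: genfun_nth fps_sum_nth)
qed

lemma size_filter_le_sum_mset:
  assumes "M \<in> pos_mset"
  shows "size (filter_mset Q M) \<le> sum_mset M"
  using assms by (induction M) (auto simp: pos_mset_def)

section \<open>q-Pochhammer products and partitions with restricted parts\<close>

text \<open>Quotients by this product are stated with denominators cleared;
  \<open>qpoch_nonzero\<close> permits cancelling afterwards.\<close>

definition qpoch :: "nat \<Rightarrow> real fps" where
  "qpoch n = (\<Prod>i=1..n. 1 - fps_X ^ i)"

lemma qpoch_0 [simp]: "qpoch 0 = 1"
  by (simp add: qpoch_def)

lemma qpoch_Suc: "qpoch (Suc n) = qpoch n * (1 - fps_X ^ Suc n)"
  by (simp add: qpoch_def)

lemma one_minus_X_power_nonzero: "1 - fps_X ^ Suc i \<noteq> (0 :: real fps)"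
proof
  assume "1 - fps_X ^ Suc i = (0 :: real fps)"
  then have "(1 - fps_X ^ Suc i) $ 0 = (0 :: real fps) $ 0" by simp
  then show False by simp
qed

lemma qpoch_nonzero: "qpoch n \<noteq> 0"
  by (induction n) (use one_minus_X_power_nonzero in \<open>auto simp: qpoch_Suc\<close>)

definition parts_ge :: "nat \<Rightarrow> nat \<Rightarrow> nat multiset set" where
  "parts_ge c B = {M. (\<forall>x\<in>#M. c \<le> x) \<and> size M = B}"

definition parts_onto :: "nat \<Rightarrow> nat \<Rightarrow> nat multiset set" where
  "parts_onto k m = {M. set_mset M = {1..k} \<and> size M \<le> m}"

definition parts_le :: "nat \<Rightarrow> nat multiset set" where
  "parts_le k = {M. set_mset M \<subseteq> {1..k}}"

lemma parts_ge_subset: "0 < c \<Longrightarrow> parts_ge c B \<subseteq> pos_mset"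
  by (auto simp: parts_ge_def pos_mset_def)

lemma parts_onto_subset: "parts_onto k m \<subseteq> pos_mset"
  by (auto simp: parts_onto_def pos_mset_def)

lemma parts_le_subset: "parts_le k \<subseteq> pos_mset"
  by (auto simp: parts_le_def pos_mset_def)

text \<open>Parts equal to \<open>c\<close> are removed one at a time; if there are none, all parts are lowered by 1,
  so the recurrence stays at the same \<open>c\<close>.\<close>

lemma genfun_parts_ge:
  assumes "0 < c"
  shows "genfun (parts_ge c B) * qpoch B = fps_X ^ (c * B)"
proof (induction B)
  case 0
  have "parts_ge c 0 = {{#}}" by (auto simp: parts_ge_def)
  then show ?case by (simp add: genfun_unit)
next
  case (Suc B)
  have shift: "image_mset Suc ` parts_ge c (Suc B) = parts_ge (Suc c) (Suc B)"
  proof (intro equalityI subsetI)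
    fix M assume M: "M \<in> parts_ge (Suc c) (Suc B)"
    then have "M = image_mset Suc (image_mset (\<lambda>x. x - 1) M)"
      by (auto simp: parts_ge_def multiset.map_comp o_def intro!: multiset.map_ident_strong[symmetric])
    moreover have "image_mset (\<lambda>x. x - 1) M \<in> parts_ge c (Suc B)"
      using M by (auto simp: parts_ge_def)
    ultimately show "M \<in> image_mset Suc ` parts_ge c (Suc B)" by blast
  qed (auto simp: parts_ge_def)
  have split: "parts_ge c (Suc B) = add_mset c ` parts_ge c B \<union> image_mset Suc ` parts_ge c (Suc B)"
    unfolding shift
  proof (intro equalityI subsetI)
    fix M assume M: "M \<in> parts_ge c (Suc B)"
    show "M \<in> add_mset c ` parts_ge c B \<union> parts_ge (Suc c) (Suc B)"
    proof (cases "c \<in># M")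
      case True
      then obtain N where "M = add_mset c N" by (metis multi_member_split)
      then show ?thesis using M by (auto simp: parts_ge_def)
    next
      case False
      then show ?thesis using M by (force simp: parts_ge_def le_less Suc_le_eq)
    qed
  qed (auto simp: parts_ge_def)
  have "genfun (parts_ge c (Suc B)) = genfun (add_mset c ` parts_ge c B) + genfun (image_mset Suc ` parts_ge c (Suc B))"
    unfolding shift
    by (subst split[unfolded shift], rule genfun_Un) (use assms in \<open>auto simp: parts_ge_def pos_mset_def\<close>)
  also have "genfun (image_mset Suc ` parts_ge c (Suc B)) = fps_X ^ Suc B * genfun (parts_ge c (Suc B))"
  proof (rule genfun_image)
    show "inj_on (image_mset Suc) (parts_ge c (Suc B))"
      by (rule inj_on_subset[OF multiset.inj_map]) auto
    show "sum_mset (image_mset Suc M) = Suc B + sum_mset M" if "M \<in> parts_ge c (Suc B)" for M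
    proof -
      have "sum_mset (image_mset Suc M) = size M + sum_mset M" by (induction M) auto
      then show ?thesis using that by (simp add: parts_ge_def)
    qed
  qed
  finally have "genfun (parts_ge c (Suc B)) * (1 - fps_X ^ Suc B) = fps_X ^ c * genfun (parts_ge c B)"
    by (simp add: genfun_add_mset algebra_simps)
  then have "genfun (parts_ge c (Suc B)) * qpoch (Suc B) = fps_X ^ c * (genfun (parts_ge c B) * qpoch B)"
    by (simp add: qpoch_Suc mult_ac)
  then show ?case by (simp add: Suc power_add)
qed

text \<open>If \<open>Suc k\<close> occurs, removing one copy leaves a partition with the same bound
  on its parts; this yields the factor \<open>1 - fps_X ^ Suc k\<close>.\<close>

lemma genfun_parts_le: "genfun (parts_le k) * qpoch k = 1"
proof (induction k)
  case 0
  have "parts_le 0 = {{#}}" by (auto simp: parts_le_def)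
  then show ?case by (simp add: genfun_unit)
next
  case (Suc k)
  have split: "parts_le (Suc k) = parts_le k \<union> add_mset (Suc k) ` parts_le (Suc k)"
  proof (intro equalityI subsetI)
    fix M assume M: "M \<in> parts_le (Suc k)"
    show "M \<in> parts_le k \<union> add_mset (Suc k) ` parts_le (Suc k)"
    proof (cases "Suc k \<in># M")
      case True
      then obtain N where "M = add_mset (Suc k) N" by (metis multi_member_split)
      then show ?thesis using M by (auto simp: parts_le_def)
    next
      case False
      then show ?thesis using M by (auto simp: parts_le_def atLeastAtMostSuc_conv)
    qed
  qed (auto simp: parts_le_def)
  have "genfun (parts_le (Suc k)) = genfun (parts_le k) + genfun (add_mset (Suc k) ` parts_le (Suc k))"
    by (subst split, rule genfun_Un) (auto simp: parts_le_def pos_mset_def)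
  then have "genfun (parts_le (Suc k)) * (1 - fps_X ^ Suc k) = genfun (parts_le k)"
    by (simp add: genfun_add_mset algebra_simps)
  then have "genfun (parts_le (Suc k)) * qpoch (Suc k) = genfun (parts_le k) * qpoch k"
    by (simp add: qpoch_Suc mult_ac)
  then show ?case using Suc by simp
qed

lemma genfun_parts_onto_0: "genfun (parts_onto 0 m) = 1"
proof -
  have "parts_onto 0 m = {{#}}" by (auto simp: parts_onto_def)
  then show ?thesis by (simp add: genfun_unit)
qed

text \<open>Remove one copy of \<open>Suc k\<close>: the remaining parts take either all values in
  \<open>{1..Suc k}\<close> or exactly those in \<open>{1..k}\<close>. This plays the role of the
  q-Pascal rule.\<close>

lemma genfun_parts_onto_Suc:
  "genfun (parts_onto (Suc k) (Suc m))
    = fps_X ^ Suc k * (genfun (parts_onto (Suc k) m) + genfun (parts_onto k m))"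
proof -
  have "parts_onto (Suc k) (Suc m) = add_mset (Suc k) ` (parts_onto (Suc k) m \<union> parts_onto k m)"
  proof (intro equalityI subsetI)
    fix M assume M: "M \<in> parts_onto (Suc k) (Suc m)"
    then have "Suc k \<in># M" by (auto simp: parts_onto_def)
    then obtain N where N: "M = add_mset (Suc k) N" by (metis multi_member_split)
    have "set_mset N = {1..Suc k} \<or> set_mset N = {1..k}"
    proof (cases "Suc k \<in># N")
      case True
      then show ?thesis using M N by (simp add: parts_onto_def insert_absorb)
    next
      case False
      then have "set_mset N = set_mset M - {Suc k}" using N by auto
      also have "\<dots> = {1..Suc k} - {Suc k}" using M by (simp add: parts_onto_def)
      also have "\<dots> = {1..k}" by auto
      finally show ?thesis by simp
    qed
    moreover have "size N \<le> m" using M N by (simp add: parts_onto_def)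
    ultimately have "N \<in> parts_onto (Suc k) m \<union> parts_onto k m" unfolding parts_onto_def by blast
    then show "M \<in> add_mset (Suc k) ` (parts_onto (Suc k) m \<union> parts_onto k m)"
      unfolding N by (rule imageI)
  next
    fix M assume "M \<in> add_mset (Suc k) ` (parts_onto (Suc k) m \<union> parts_onto k m)"
    then obtain N where N: "M = add_mset (Suc k) N" "N \<in> parts_onto (Suc k) m \<union> parts_onto k m"
      by blast
    then have "set_mset N = {1..Suc k} \<or> set_mset N = {1..k}" "size N \<le> m"
      unfolding parts_onto_def by blast+
    moreover have "insert (Suc k) {1..k} = {1..Suc k}" "insert (Suc k) {1..Suc k} = {1..Suc k}"
      by auto
    ultimately have "set_mset M = {1..Suc k}" "size M \<le> Suc m"
      by (metis N(1) set_mset_add_mset_insert, simp add: N(1))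
    then show "M \<in> parts_onto (Suc k) (Suc m)" unfolding parts_onto_def by blast
  qed
  moreover have "genfun (parts_onto (Suc k) m \<union> parts_onto k m) = genfun (parts_onto (Suc k) m) + genfun (parts_onto k m)"
  proof (rule genfun_Un)
    have "Suc k \<in># M" if "M \<in> parts_onto (Suc k) m" for M using that by (simp add: parts_onto_def)
    moreover have "Suc k \<notin># M" if "M \<in> parts_onto k m" for M using that by (simp add: parts_onto_def)
    ultimately show "parts_onto (Suc k) m \<inter> parts_onto k m = {}" by blast
  qed (rule parts_onto_subset)+
  ultimately show ?thesis by (simp add: genfun_add_mset)
qed

lemma genfun_parts_onto_less: "m < k \<Longrightarrow> genfun (parts_onto k m) = 0"
proof -
  assume "m < k"
  have "k \<le> size M" if "set_mset M = {1..k}" for M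
  proof -
    have "card (set_mset M) \<le> size M"
      by (metis finite_set_mset mset_set_set_mset_msubset size_mset_mono size_mset_set)
    then show ?thesis using that by simp
  qed
  note le = this
  have "parts_onto k m = {}"
  proof (rule equals0I)
    fix M assume "M \<in> parts_onto k m"
    then have "set_mset M = {1..k}" "size M \<le> m" unfolding parts_onto_def by blast+
    with le[of M] \<open>m < k\<close> show False by linarith
  qed
  then show ?thesis by (simp add: genfun_empty)
qed

text \<open>Apart from the power of \<open>fps_X\<close>, which accounts for one copy of each of the
  values 1 to \<open>k\<close>, this is the Gaussian binomial coefficient of \<open>k + d\<close>
  over \<open>k\<close>. The recurrence lowers either \<open>k\<close> or \<open>d\<close>, hence
  the nested induction.\<close>

lemma genfun_parts_onto:
  "genfun (parts_onto k (k + d)) * qpoch k * qpoch d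
    = fps_X ^ (\<Sum>{1..k}) * qpoch (k + d)"
proof (induction k arbitrary: d)
  case 0
  then show ?case by (simp add: genfun_parts_onto_0)
next
  case (Suc k)
  note IH = Suc.IH
  show ?case
  proof (induction d)
    case 0
    \<comment> \<open>The summand for \<open>parts_onto (Suc k) k\<close> drops out:
      \<open>k\<close> parts cannot take \<open>Suc k\<close> distinct values.\<close>
    have "genfun (parts_onto (Suc k) (Suc k)) = fps_X ^ Suc k * genfun (parts_onto k k)"
      by (simp add: genfun_parts_onto_Suc genfun_parts_onto_less)
    moreover have "genfun (parts_onto k k) * qpoch k = fps_X ^ (\<Sum>{1..k}) * qpoch k"
      using IH[of 0] by simp
    ultimately have "genfun (parts_onto (Suc k) (Suc k)) * qpoch k = fps_X ^ Suc k * (fps_X ^ (\<Sum>{1..k}) * qpoch k)"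
      by (metis mult.assoc)
    also have "\<dots> = fps_X ^ (\<Sum>{1..Suc k}) * qpoch k"
      by (simp add: power_add mult_ac)
    finally show ?case by (simp only: qpoch_Suc qpoch_0 add_0_right mult_1_right mult.assoc[symmetric])
  next
    case (Suc d)
    let ?s = "\<Sum>{1..k}"
    let ?q = "qpoch (k + Suc d)"
    have a: "genfun (parts_onto (Suc k) (k + Suc d)) * (qpoch k * (1 - fps_X ^ Suc k)) * qpoch d
        = fps_X ^ Suc k * (fps_X ^ ?s * ?q)"
    proof -
      have "fps_X ^ (\<Sum>{1..Suc k}) = fps_X ^ Suc k * (fps_X ^ ?s :: real fps)"
        by (simp add: power_add mult_ac)
      then show ?thesis using Suc by (simp only: qpoch_Suc[of k] add_Suc_shift mult.assoc)
    qed
    have b: "genfun (parts_onto k (k + Suc d)) * qpoch k * qpoch (Suc d) = fps_X ^ ?s * ?q"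
      by (rule IH)
    have "genfun (parts_onto (Suc k) (Suc k + Suc d)) * qpoch (Suc k) * qpoch (Suc d)
      = fps_X ^ Suc k * ((genfun (parts_onto (Suc k) (k + Suc d)) * (qpoch k * (1 - fps_X ^ Suc k)) * qpoch d) * (1 - fps_X ^ Suc d)
         + (genfun (parts_onto k (k + Suc d)) * qpoch k * qpoch (Suc d)) * (1 - fps_X ^ Suc k))"
    proof -
      have "x * (u + v) * (p * y) * (r * w) = x * ((u * (p * y) * r) * w + (v * p * (r * w)) * y)"
        for x u v p y r w :: "real fps"
        by (simp add: algebra_simps)
      then show ?thesis by (simp only: add_Suc genfun_parts_onto_Suc qpoch_Suc[of k] qpoch_Suc[of d])
    qed
    \<comment> \<open>With \<open>x = fps_X ^ Suc k\<close> and \<open>y = fps_X ^ Suc d\<close>,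
      the identity \<open>x (1 - y) + (1 - x) = 1 - x y\<close> produces the last factor of the
      longer product.\<close>
    also have "\<dots> = fps_X ^ Suc k * fps_X ^ ?s * (?q * (1 - fps_X ^ Suc k * fps_X ^ Suc d))"
    proof -
      have "x * (x * (s * q) * (1 - y) + s * q * (1 - x)) = x * s * (q * (1 - x * y))"
        for x s q y :: "real fps"
        by (simp add: algebra_simps)
      then show ?thesis by (simp only: a b)
    qed
    also have "\<dots> = fps_X ^ (\<Sum>{1..Suc k}) * qpoch (Suc k + Suc d)"
    proof -
      have "fps_X ^ (\<Sum>{1..Suc k}) = fps_X ^ Suc k * (fps_X ^ ?s :: real fps)"
        by (simp add: power_add mult_ac)
      moreover have "fps_X ^ Suc (k + Suc d) = fps_X ^ Suc k * (fps_X ^ Suc d :: real fps)"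
        by (simp flip: power_add)
      ultimately show ?thesis by (simp only: add_Suc qpoch_Suc[of "k + Suc d"] mult.assoc)
    qed
    finally show ?case .
  qed
qed

section \<open>Cutting partitions at a given size\<close>

text \<open>Cut at \<open>k\<close> and classify by the number \<open>B\<close> of parts above
  \<open>k\<close>. The parts up to \<open>k\<close> are unrestricted, so each class is a
  product.\<close>

lemma genfun_nth_partition:
  assumes "n < N"
  shows "genfun pos_mset $ n = (\<Sum>B<N. genfun (parts_le k) * genfun (parts_ge (Suc k) B)) $ n"
proof -
  have "{M \<in> pos_mset. size (filter_mset (\<lambda>x. k < x) M) = B}
      = (\<lambda>(M, N). M + N) ` (parts_le k \<times> parts_ge (Suc k) B)" (is "?L = ?R") for B
  proof (intro equalityI subsetI)
    fix M assume M: "M \<in> ?L"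
    have "M = filter_mset (\<lambda>x. \<not> k < x) M + filter_mset (\<lambda>x. k < x) M"
      by (metis add.commute multiset_partition)
    moreover have "filter_mset (\<lambda>x. \<not> k < x) M \<in> parts_le k"
      using M by (auto simp: parts_le_def pos_mset_def Suc_le_eq intro!: gr0I)
    moreover have "filter_mset (\<lambda>x. k < x) M \<in> parts_ge (Suc k) B"
      using M by (auto simp: parts_ge_def)
    ultimately show "M \<in> ?R" by (metis (no_types, lifting) SigmaI case_prod_conv image_eqI)
  next
    fix M assume "M \<in> ?R"
    then obtain S T where M: "M = S + T" and S: "S \<in> parts_le k" and T: "T \<in> parts_ge (Suc k) B" by auto
    have "filter_mset (\<lambda>x. k < x) S = {#}" "filter_mset (\<lambda>x. k < x) T = T"
      using S T by (auto simp: parts_le_def parts_ge_def filter_mset_eq_conv)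
    moreover have "M \<in> pos_mset"
      using M S T parts_le_subset[of k] parts_ge_subset[of "Suc k" B] by (auto simp: pos_mset_def)
    ultimately show "M \<in> ?L" using M T by (simp add: parts_ge_def)
  qed
  moreover have "genfun ((\<lambda>(M, N). M + N) ` (parts_le k \<times> parts_ge (Suc k) B)) = genfun (parts_le k) * genfun (parts_ge (Suc k) B)" for B
    by (rule genfun_plus[where Q = "\<lambda>x. x \<le> k"]) (use parts_le_subset parts_ge_subset in \<open>auto simp: parts_le_def parts_ge_def\<close>)
  ultimately show ?thesis
    using genfun_nth_sum[where s = "\<lambda>M. size (filter_mset (\<lambda>x. k < x) M)", OF subset_refl size_filter_le_sum_mset assms] by simp
qed

definition mex_top_heavy :: "nat \<Rightarrow> nat multiset set" where
  "mex_top_heavy l = {M \<in> pos_mset. {1..<l} \<subseteq> set_mset M \<and> l \<notin># M \<and>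
     size (filter_mset (\<lambda>x. x < l) M) < size (filter_mset (\<lambda>x. l < x) M)}"

lemma M_fun_eq:
  assumes "0 < l"
  shows "real (M_fun l n) = genfun (mex_top_heavy l) $ n"
proof -
  have least: "(LEAST m. 0 < m \<and> m \<notin> A) = l \<longleftrightarrow> {1..<l} \<subseteq> A \<and> l \<notin> A" if "finite A" for A
  proof
    \<comment> \<open>A finite set misses some positive integer, so the \<open>LEAST\<close> is
      attained.\<close>
    have "\<exists>m. 0 < m \<and> m \<notin> A"
      using that by (metis finite_nat_set_iff_bounded less_irrefl zero_less_Suc not_less_eq less_Suc_eq)
    then have *: "0 < (LEAST m. 0 < m \<and> m \<notin> A) \<and> (LEAST m. 0 < m \<and> m \<notin> A) \<notin> A"
      by (rule LeastI_ex)
    assume eq: "(LEAST m. 0 < m \<and> m \<notin> A) = l"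
    have "x \<in> A" if "0 < x" "x < l" for x
      using not_less_Least[of x "\<lambda>m. 0 < m \<and> m \<notin> A"] that eq by auto
    then show "{1..<l} \<subseteq> A \<and> l \<notin> A" using * eq by auto
  next
    assume "{1..<l} \<subseteq> A \<and> l \<notin> A"
    then show "(LEAST m. 0 < m \<and> m \<notin> A) = l"
      using assms by (intro Least_equality) (force simp: subset_iff not_less[symmetric])+
  qed
  have "M_fun l n = card {M \<in> pos_mset. sum_mset M = n \<and> ({1..<l} \<subseteq> set_mset M \<and> l \<notin># M \<and>
     size (filter_mset (\<lambda>x. x < l) M) < size (filter_mset (\<lambda>x. l < x) M))}"
    unfolding M_fun_def
    by (rule card_partitions_of) (simp add: least flip: mset_filter)
  then show ?thesis
    by (simp add: genfun_nth mex_top_heavy_def conj_ac)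
qed

text \<open>Cut at the missing value \<open>Suc k\<close>. With \<open>Suc B\<close> parts above it,
  being top-heavy means at most \<open>B\<close> parts below it, and those must take all values in
  \<open>{1..k}\<close>.\<close>

lemma genfun_nth_mex_top_heavy:
  assumes "n < N"
  shows "genfun (mex_top_heavy (Suc k)) $ n = (\<Sum>B<N. genfun (parts_onto k B) * genfun (parts_ge (Suc (Suc k)) (Suc B))) $ n"
proof -
  let ?s = "\<lambda>M. size (filter_mset (\<lambda>x. Suc k < x) M)"
  have "{M \<in> mex_top_heavy (Suc k). ?s M = Suc B}
      = (\<lambda>(M, N). M + N) ` (parts_onto k B \<times> parts_ge (Suc (Suc k)) (Suc B))" (is "?L = ?R") for B
  proof (intro equalityI subsetI)
    fix M assume M: "M \<in> ?L"
    let ?S = "filter_mset (\<lambda>x. x < Suc k) M" and ?T = "filter_mset (\<lambda>x. Suc k < x) M"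
    have "M = filter_mset (\<lambda>x. \<not> Suc k < x) M + ?T"
      by (metis add.commute multiset_partition)
    also have "filter_mset (\<lambda>x. \<not> Suc k < x) M = ?S"
      using M by (intro filter_mset_cong) (auto simp: mex_top_heavy_def not_less le_less)
    finally have "M = ?S + ?T" .
    moreover have "set_mset ?S = {1..k}"
      using M by (auto simp: mex_top_heavy_def pos_mset_def Suc_le_eq intro!: gr0I)
    then have "?S \<in> parts_onto k B" using M by (simp add: parts_onto_def mex_top_heavy_def)
    moreover have "?T \<in> parts_ge (Suc (Suc k)) (Suc B)"
      using M by (auto simp: parts_ge_def)
    ultimately show "M \<in> ?R" by (metis (no_types, lifting) SigmaI case_prod_conv image_eqI)
  next
    fix M assume "M \<in> ?R"
    then obtain S T where M: "M = S + T" and S: "S \<in> parts_onto k B" and T: "T \<in> parts_ge (Suc (Suc k)) (Suc B)"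
      by auto
    have S': "set_mset S = {1..k}" "size S \<le> B" using S unfolding parts_onto_def by blast+
    have T': "\<forall>x\<in>#T. Suc (Suc k) \<le> x" "size T = Suc B" using T unfolding parts_ge_def by blast+
    have "filter_mset (\<lambda>x. Suc k < x) S = {#}" "filter_mset (\<lambda>x. Suc k < x) T = T"
      "filter_mset (\<lambda>x. x < Suc k) S = S" "filter_mset (\<lambda>x. x < Suc k) T = {#}"
      using S' T' by (force simp: filter_mset_eq_conv)+
    then have f: "filter_mset (\<lambda>x. Suc k < x) M = T" "filter_mset (\<lambda>x. x < Suc k) M = S"
      by (simp_all only: M filter_union_mset empty_neutral)
    have "M \<in> pos_mset"
      using M S T parts_onto_subset[of k B] parts_ge_subset[of "Suc (Suc k)" "Suc B"] by (auto simp: pos_mset_def)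
    moreover have "{1..<Suc k} \<subseteq> set_mset M" "Suc k \<notin># M"
      using M S' T' by auto
    ultimately show "M \<in> ?L"
      unfolding mex_top_heavy_def mem_Collect_eq f using S' T' by simp
  qed
  moreover have "genfun ((\<lambda>(M, N). M + N) ` (parts_onto k B \<times> parts_ge (Suc (Suc k)) (Suc B)))
      = genfun (parts_onto k B) * genfun (parts_ge (Suc (Suc k)) (Suc B))" for B
    by (rule genfun_plus[where Q = "\<lambda>x. x \<le> k"]) (use parts_onto_subset parts_ge_subset in \<open>auto simp: parts_onto_def parts_ge_def\<close>)
  ultimately have "genfun {M \<in> mex_top_heavy (Suc k). ?s M = Suc B}
      = genfun (parts_onto k B) * genfun (parts_ge (Suc (Suc k)) (Suc B))" for B
    by simp
  moreover have "{M \<in> mex_top_heavy (Suc k). ?s M = 0} = {}"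
  proof -
    have "?s M \<noteq> 0" if "M \<in> mex_top_heavy (Suc k)" for M
      using that unfolding mex_top_heavy_def mem_Collect_eq by linarith
    then show ?thesis by blast
  qed
  \<comment> \<open>The bound is \<open>Suc N\<close> because the empty class with no part above
    \<open>Suc k\<close> is then dropped and the index lowered by one.\<close>
  moreover have "genfun (mex_top_heavy (Suc k)) $ n = (\<Sum>B<Suc N. genfun {M \<in> mex_top_heavy (Suc k). ?s M = B}) $ n"
    by (rule genfun_nth_sum) (use assms size_filter_le_sum_mset in \<open>auto simp: mex_top_heavy_def\<close>)
  ultimately show ?thesis
    by (simp only: sum.lessThan_Suc_shift genfun_empty add_0_left)
qed

section \<open>The telescoping sum\<close>

text \<open>The series \<open>w(B)\<close>. Compared with a summand for
  \<open>mex_top_heavy (Suc k)\<close>, the value \<open>Suc k\<close> is allowed and there are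
  \<open>B\<close> instead of \<open>Suc B\<close> large parts.\<close>

definition box_term :: "nat \<Rightarrow> nat \<Rightarrow> real fps" where
  "box_term k B = genfun (parts_onto k B) * genfun (parts_ge (Suc k) B)"

lemma box_term_less: "B < k \<Longrightarrow> box_term k B = 0"
  by (simp add: box_term_def genfun_parts_onto_less)

text \<open>The numerator \<open>qpoch (k + d)\<close> of the Gaussian binomial coefficient cancels
  the denominator coming from the \<open>k + d\<close> large parts. What remains is a power of
  \<open>fps_X\<close> times the summand of \<open>genfun_nth_partition\<close>.\<close>

lemma box_term_add:
  "box_term k (k + d)
    = fps_X ^ (\<Sum>{1..k} + Suc k * k) * (genfun (parts_le k) * genfun (parts_ge (Suc k) d))"
proof -
  let ?q = "qpoch k * qpoch d * qpoch (k + d)"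
  have "box_term k (k + d) * ?q = (genfun (parts_onto k (k + d)) * qpoch k * qpoch d) * (genfun (parts_ge (Suc k) (k + d)) * qpoch (k + d))"
    by (simp add: box_term_def mult_ac)
  also have "\<dots> = fps_X ^ (\<Sum>{1..k}) * qpoch (k + d) * fps_X ^ (Suc k * (k + d))"
    by (simp only: genfun_parts_onto genfun_parts_ge[OF zero_less_Suc])
  also have "\<dots> = fps_X ^ (\<Sum>{1..k} + Suc k * k) * (1 * fps_X ^ (Suc k * d)) * qpoch (k + d)"
    by (simp only: distrib_left power_add mult_1_left mult_ac)
  also have "\<dots> = fps_X ^ (\<Sum>{1..k} + Suc k * k) * (genfun (parts_le k) * genfun (parts_ge (Suc k) d)) * ?q"
    unfolding genfun_parts_le[of k, symmetric] genfun_parts_ge[OF zero_less_Suc, symmetric] by (simp only: mult_ac)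
  finally show ?thesis by (simp add: qpoch_nonzero)
qed

text \<open>Coefficient \<open>n\<close> of a product involves only coefficients up to
  \<open>n\<close> of each factor, so truncated sums may replace full series inside
  products.\<close>

lemma fps_mult_nth_cong:
  fixes f g h :: "'a :: comm_ring_1 fps"
  assumes "\<And>i. i < N \<Longrightarrow> f $ i = g $ i" "n < N"
  shows "(h * f) $ n = (h * g) $ n"
  using assms by (auto simp: fps_mult_nth intro!: sum.cong)

text \<open>Terms with \<open>B < k\<close> vanish; the others, by \<open>box_term_add\<close>, sum
  to all partitions cut at \<open>k\<close>.\<close>

lemma box_term_sum_nth:
  assumes "n < N"
  shows "(\<Sum>B<k + N. box_term k B) $ n = (fps_X ^ (\<Sum>{1..k} + Suc k * k) * genfun pos_mset) $ n"
proof -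
  have "(\<Sum>B<k + N. box_term k B) = (\<Sum>d<N. box_term k (k + d))"
    by (induction N) (simp_all add: box_term_less)
  also have "\<dots> = fps_X ^ (\<Sum>{1..k} + Suc k * k) * (\<Sum>d<N. genfun (parts_le k) * genfun (parts_ge (Suc k) d))"
    unfolding box_term_add by (rule sum_distrib_left[symmetric])
  also have "\<dots> $ n = (fps_X ^ (\<Sum>{1..k} + Suc k * k) * genfun pos_mset) $ n"
    by (rule fps_mult_nth_cong[OF _ assms]) (rule genfun_nth_partition[symmetric])
  finally show ?thesis .
qed

text \<open>Multiply by \<open>qpoch (Suc B)\<close>; all series become polynomials in
  \<open>?a\<close>, \<open>?t\<close> and the \<open>parts_onto\<close> series. The recurrence for
  \<open>parts_onto k (Suc B)\<close> brings in one unwanted term, and subtracting its multiple by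
  \<open>1 - ?t\<close> leaves just the required multiple by \<open>?t\<close>.\<close>

lemma box_term_diff:
  assumes k: "k = Suc j"
  shows "fps_X ^ k * (genfun (parts_onto j B) * genfun (parts_ge (Suc k) (Suc B)) + genfun (parts_onto k B) * genfun (parts_ge (Suc (Suc k)) (Suc B)))
    = box_term k (Suc B) - fps_X ^ (2 * k + 1) * box_term k B"
proof -
  let ?a = "fps_X ^ (Suc k * Suc B) :: real fps" and ?t = "fps_X ^ Suc B :: real fps"
  have u: "genfun (parts_ge (Suc k) (Suc B)) * qpoch (Suc B) = ?a"
    by (rule genfun_parts_ge) simp
  have "genfun (parts_ge (Suc (Suc k)) (Suc B)) * qpoch (Suc B) = fps_X ^ (Suc (Suc k) * Suc B)"
    by (rule genfun_parts_ge) simp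
  also have "\<dots> = ?a * ?t"
    by (simp flip: power_add add: algebra_simps)
  finally have v: "genfun (parts_ge (Suc (Suc k)) (Suc B)) * qpoch (Suc B) = ?a * ?t" .
  have z: "genfun (parts_onto k (Suc B)) = fps_X ^ k * (genfun (parts_onto k B) + genfun (parts_onto j B))"
    unfolding k by (rule genfun_parts_onto_Suc)
  have "fps_X ^ (2 * k + 1) * box_term k B * qpoch (Suc B)
      = genfun (parts_onto k B) * (fps_X ^ (2 * k + 1) * (genfun (parts_ge (Suc k) B) * qpoch B)) * (1 - ?t)"
    by (simp only: box_term_def qpoch_Suc mult_ac)
  \<comment> \<open>The factor \<open>fps_X ^ (2 * k + 1)\<close> is chosen for this:
    \<open>2k + 1 + (k+1)B = k + (k+1)(B+1)\<close>.\<close>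
  also have "fps_X ^ (2 * k + 1) * (genfun (parts_ge (Suc k) B) * qpoch B) = fps_X ^ k * ?a"
    unfolding genfun_parts_ge[OF zero_less_Suc] by (simp flip: power_add add: algebra_simps)
  finally have w: "fps_X ^ (2 * k + 1) * box_term k B * qpoch (Suc B) = genfun (parts_onto k B) * (fps_X ^ k * ?a) * (1 - ?t)" .
  have w': "box_term k (Suc B) * qpoch (Suc B) = fps_X ^ k * (genfun (parts_onto k B) + genfun (parts_onto j B)) * ?a"
    unfolding box_term_def z u[symmetric] by (simp only: mult_ac)
  have "fps_X ^ k * (genfun (parts_onto j B) * genfun (parts_ge (Suc k) (Suc B)) + genfun (parts_onto k B) * genfun (parts_ge (Suc (Suc k)) (Suc B)))
      * qpoch (Suc B)
    = fps_X ^ k * (genfun (parts_onto j B) * (genfun (parts_ge (Suc k) (Suc B)) * qpoch (Suc B))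
        + genfun (parts_onto k B) * (genfun (parts_ge (Suc (Suc k)) (Suc B)) * qpoch (Suc B)))"
    by (simp only: ring_distribs mult.assoc)
  also have "\<dots> = fps_X ^ k * (genfun (parts_onto j B) * ?a + genfun (parts_onto k B) * (?a * ?t))"
    unfolding u v ..
  also have "\<dots> = fps_X ^ k * (genfun (parts_onto k B) + genfun (parts_onto j B)) * ?a - genfun (parts_onto k B) * (fps_X ^ k * ?a) * (1 - ?t)"
  proof -
    have "x * (zj * a + zk * (a * t)) = x * (zk + zj) * a - zk * (x * a) * (1 - t)"
      for x zj zk a t :: "real fps" by (simp add: algebra_simps)
    then show ?thesis by (simp only:)
  qed
  also have "\<dots> = (box_term k (Suc B) - fps_X ^ (2 * k + 1) * box_term k B) * qpoch (Suc B)"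
    by (simp only: left_diff_distrib w w')
  finally show ?thesis by (simp add: qpoch_nonzero)
qed

text \<open>Sum \<open>box_term_diff\<close> over \<open>B\<close>. Since \<open>k\<close> is
  positive, \<open>box_term k 0\<close> vanishes, so the shifted and unshifted sums agree in the
  limit and give the factor \<open>1 - fps_X ^ (2 * k + 1)\<close>; finally \<open>fps_X ^ k\<close>
  is cancelled.\<close>

lemma mex_top_heavy_add_Suc:
  assumes k: "k = Suc j"
  shows "genfun (mex_top_heavy k) + genfun (mex_top_heavy (Suc k))
    = fps_X ^ (\<Sum>{1..k} + k * k) * (1 - fps_X ^ (2 * k + 1)) * genfun pos_mset"
proof -
  let ?E = "\<Sum>{1..k} + Suc k * k" and ?e = "2 * k + 1"
  have "fps_X ^ k * (genfun (mex_top_heavy k) + genfun (mex_top_heavy (Suc k)))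
      = fps_X ^ ?E * genfun pos_mset - fps_X ^ ?e * (fps_X ^ ?E * genfun pos_mset)"
  proof (rule fps_ext)
    fix n
    \<comment> \<open>\<open>box_term_sum_nth\<close> needs more than \<open>n\<close> terms from
      index \<open>k\<close> on. This holds for the sum below \<open>?N\<close> and for the shifted
      one, which reaches one index further.\<close>
    let ?N = "k + Suc n"
    have "(fps_X ^ k * (genfun (mex_top_heavy k) + genfun (mex_top_heavy (Suc k)))) $ n
      = (fps_X ^ k * (\<Sum>B<?N. genfun (parts_onto j B) * genfun (parts_ge (Suc k) (Suc B))
          + genfun (parts_onto k B) * genfun (parts_ge (Suc (Suc k)) (Suc B)))) $ n"
    proof (rule fps_mult_nth_cong)
      fix i assume "i < ?N"
      then show "(genfun (mex_top_heavy k) + genfun (mex_top_heavy (Suc k))) $ i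
        = (\<Sum>B<?N. genfun (parts_onto j B) * genfun (parts_ge (Suc k) (Suc B))
          + genfun (parts_onto k B) * genfun (parts_ge (Suc (Suc k)) (Suc B))) $ i"
        by (simp only: fps_add_nth sum.distrib genfun_nth_mex_top_heavy[of i ?N] k)
    qed simp
    also have "\<dots> = (\<Sum>B<?N. box_term k (Suc B) - fps_X ^ ?e * box_term k B) $ n"
      by (simp only: sum_distrib_left box_term_diff[OF k])
    also have "(\<Sum>B<?N. box_term k (Suc B) - fps_X ^ ?e * box_term k B)
        = (\<Sum>B<k + Suc (Suc n). box_term k B) - fps_X ^ ?e * (\<Sum>B<?N. box_term k B)"
    proof -
      have "(\<Sum>B<k + Suc (Suc n). box_term k B) = box_term k 0 + (\<Sum>B<?N. box_term k (Suc B))"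
        by (metis add_Suc_right sum.lessThan_Suc_shift)
      moreover have "box_term k 0 = 0" using k by (simp add: box_term_less)
      ultimately show ?thesis by (simp only: sum_subtractf sum_distrib_left add_0_left)
    qed
    also have "\<dots> $ n = (fps_X ^ ?E * genfun pos_mset - fps_X ^ ?e * (fps_X ^ ?E * genfun pos_mset)) $ n"
    proof -
      have "(\<Sum>B<k + Suc (Suc n). box_term k B) $ n = (fps_X ^ ?E * genfun pos_mset) $ n"
        by (rule box_term_sum_nth) simp
      moreover have "(fps_X ^ ?e * (\<Sum>B<?N. box_term k B)) $ n = (fps_X ^ ?e * (fps_X ^ ?E * genfun pos_mset)) $ n"
        by (rule fps_mult_nth_cong[of "Suc n"]) (simp_all only: box_term_sum_nth lessI)
      ultimately show ?thesis by (simp only: fps_sub_nth)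
    qed
    finally show "(fps_X ^ k * (genfun (mex_top_heavy k) + genfun (mex_top_heavy (Suc k)))) $ n
      = (fps_X ^ ?E * genfun pos_mset - fps_X ^ ?e * (fps_X ^ ?E * genfun pos_mset)) $ n" .
  qed
  also have "\<dots> = fps_X ^ k * (fps_X ^ (\<Sum>{1..k} + k * k) * (1 - fps_X ^ ?e) * genfun pos_mset)"
  proof -
    have "fps_X ^ ?E = fps_X ^ k * (fps_X ^ (\<Sum>{1..k} + k * k) :: real fps)"
      by (simp flip: power_add add: algebra_simps)
    moreover have "x * y * p - z * (x * y * p) = x * (y * (1 - z) * p)" for x y z p :: "real fps"
      by (simp add: algebra_simps)
    ultimately show ?thesis by (simp only:)
  qed
  finally show ?thesis by simp
qed

text \<open>A nonempty partition without the part 1 is automatically top-heavy, as nothing lies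
  below 1. The partitions containing 1 arise from all partitions by adding a 1.\<close>

lemma mex_top_heavy_1: "1 + genfun (mex_top_heavy 1) = (1 - fps_X) * genfun pos_mset"
proof -
  have split: "pos_mset = ({{#}} \<union> mex_top_heavy 1) \<union> add_mset 1 ` pos_mset"
  proof (intro equalityI subsetI)
    fix M assume M: "M \<in> pos_mset"
    show "M \<in> ({{#}} \<union> mex_top_heavy 1) \<union> add_mset 1 ` pos_mset"
    proof (cases "1 \<in># M")
      case True
      then obtain N where "M = add_mset 1 N" by (metis multi_member_split)
      then show ?thesis using M by (auto simp: pos_mset_def)
    next
      case False
      then have "filter_mset (\<lambda>x. x < 1) M = {#}" "filter_mset (\<lambda>x. 1 < x) M = M"
        using M by (auto simp: pos_mset_def filter_mset_eq_conv intro: Suc_lessI gr0I)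
      then have "size (filter_mset (\<lambda>x. x < 1) M) < size (filter_mset (\<lambda>x. 1 < x) M)" if "M \<noteq> {#}"
        using that by (metis nonempty_has_size size_empty)
      then show ?thesis using M False by (auto simp: mex_top_heavy_def)
    qed
  qed (auto simp: pos_mset_def mex_top_heavy_def)
  have "genfun pos_mset = genfun ({{#}} \<union> mex_top_heavy 1) + genfun (add_mset 1 ` pos_mset)"
    by (subst split, rule genfun_Un) (auto simp: pos_mset_def mex_top_heavy_def)
  also have "genfun ({{#}} \<union> mex_top_heavy 1) = 1 + genfun (mex_top_heavy 1)"
    unfolding genfun_unit[symmetric] by (rule genfun_Un) (auto simp: pos_mset_def mex_top_heavy_def)
  finally show ?thesis by (simp add: genfun_add_mset algebra_simps)
qed

section \<open>Pentagonal numbers and the truncated pentagonal number theorem\<close>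

text \<open>A natural number, to serve as exponent; \<open>int_pent\<close> shows that
  \<open>nat\<close> truncates nothing.\<close>

definition pent :: "int \<Rightarrow> nat" where
  "pent j = nat (j * (3 * j - 1) div 2)"

lemma int_pent: "int (pent j) = j * (3 * j - 1) div 2"
proof -
  have "0 \<le> j * (3 * j - 1)"
    by (cases "0 < j") (auto intro: mult_nonneg_nonneg mult_nonpos_nonpos)
  then show ?thesis by (simp add: pent_def)
qed

text \<open>The exponent is put in the shape of \<open>mex_top_heavy_add_Suc\<close>; the partner
  index \<open>int k + 1\<close> exceeds it by \<open>2 * k + 1\<close>.\<close>

lemma pent_minus: "pent (- int k) = \<Sum>{1..k} + k * k"
proof -
  have "2 * int (\<Sum>{1..k}) = int k * (int k + 1)"
    by (induction k) (auto simp: algebra_simps)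
  then have "- int k * (3 * (- int k) - 1) = 2 * int (\<Sum>{1..k} + k * k)"
    by (simp add: algebra_simps)
  then show ?thesis
    unfolding pent_def by (metis nat_int nonzero_mult_div_cancel_left zero_neq_numeral)
qed

lemma pent_plus: "pent (int k + 1) = \<Sum>{1..k} + k * k + (2 * k + 1)"
proof -
  have "2 * int (\<Sum>{1..k}) = int k * (int k + 1)"
    by (induction k) (auto simp: algebra_simps)
  then have "(int k + 1) * (3 * (int k + 1) - 1) = 2 * int (\<Sum>{1..k} + k * k + (2 * k + 1))"
    by (simp add: algebra_simps)
  then show ?thesis
    unfolding pent_def by (metis nat_int nonzero_mult_div_cancel_left zero_neq_numeral)
qed

text \<open>Passing from \<open>m\<close> to \<open>Suc m\<close> adds the indices
  \<open>- int (Suc m)\<close> and \<open>int (Suc m) + 1\<close>, with opposite signs. By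
  \<open>mex_top_heavy_add_Suc\<close> they contribute the series for \<open>Suc m\<close> and
  \<open>Suc (Suc m)\<close> with a common sign; the former cancels the error term of the induction
  hypothesis.\<close>

theorem truncated_pentagonal_number_theorem:
  "(\<Sum>j\<in>{- int m..int m + 1}. fps_const ((-1) powi j) * fps_X ^ pent j) * genfun pos_mset
    = 1 + fps_const ((-1) ^ m) * genfun (mex_top_heavy (Suc m))"
proof (induction m)
  case 0
  have "{- int 0..int 0 + 1} = {0, 1}" by auto
  then have "(\<Sum>j\<in>{- int 0..int 0 + 1}. fps_const ((-1) powi j) * fps_X ^ pent j) = (1 - fps_X :: real fps)"
    by (simp add: pent_def flip: fps_const_neg)
  then show ?case
    using mex_top_heavy_1 by (simp only: power_0 fps_const_1_eq_1 mult_1_left One_nat_def)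
next
  case (Suc m)
  let ?k = "Suc m"
  let ?f = "\<lambda>j. fps_const ((-1) powi j) * fps_X ^ pent j :: real fps"
  let ?c = "fps_const ((-1) ^ ?k) :: real fps"
  have "{- int ?k..int ?k + 1} = insert (- int ?k) (insert (int ?k + 1) {- int m..int m + 1})"
    by auto
  then have "sum ?f {- int ?k..int ?k + 1} = ?f (- int ?k) + (?f (int ?k + 1) + sum ?f {- int m..int m + 1})"
    by simp
  \<comment> \<open>The negative exponent is harmless because -1 is its own inverse.\<close>
  also have "?f (- int ?k) = ?c * fps_X ^ (\<Sum>{1..?k} + ?k * ?k)"
    by (simp only: pent_minus power_int_minus power_int_of_nat power_inverse[symmetric] inverse_minus_eq inverse_1)
  also have "?f (int ?k + 1) = - ?c * (fps_X ^ (\<Sum>{1..?k} + ?k * ?k) * fps_X ^ (2 * ?k + 1))"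
  proof -
    have "(-1) powi (int ?k + 1) = - ((-1) ^ ?k :: real)"
      by (metis add.commute of_nat_Suc power_int_of_nat power_Suc mult_minus1)
    then show ?thesis by (simp only: pent_plus power_add fps_const_neg)
  qed
  finally have "sum ?f {- int ?k..int ?k + 1} * genfun pos_mset
      = ?c * (fps_X ^ (\<Sum>{1..?k} + ?k * ?k) * (1 - fps_X ^ (2 * ?k + 1)) * genfun pos_mset)
        + sum ?f {- int m..int m + 1} * genfun pos_mset"
    by (simp only: ring_distribs mult.assoc mult_minus_left mult_minus_right mult_1_left) simp
  also have "\<dots> = ?c * (genfun (mex_top_heavy ?k) + genfun (mex_top_heavy (Suc ?k)))
      + (1 + fps_const ((-1) ^ m) * genfun (mex_top_heavy ?k))"
    by (simp only: mex_top_heavy_add_Suc[OF refl] Suc)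
  also have "\<dots> = 1 + ?c * genfun (mex_top_heavy (Suc ?k))"
  proof -
    have "?c = - fps_const ((-1) ^ m)" by simp
    then show ?thesis by (simp only: ring_distribs) (simp flip: fps_const_neg)
  qed
  finally show ?case .
qed

section \<open>The generating function of \<open>b_fun\<close> and the convolution\<close>

definition weight_fps :: "nat \<Rightarrow> real fps" where
  "weight_fps k = Abs_fps (\<lambda>n. if k dvd n then real (n div k) else 0)"

lemma weight_fps_mult_nth:
  assumes "0 < k"
  shows "(weight_fps k * f) $ n = (\<Sum>j=1..n div k. real j * f $ (n - k * j))"
proof -
  have "(weight_fps k * f) $ n = (\<Sum>i=0..n. (if k dvd i then real (i div k) else 0) * f $ (n - i))"
    by (simp add: fps_mult_nth weight_fps_def)
  also have "\<dots> = (\<Sum>i\<in>(\<lambda>j. k * j) ` {1..n div k}. (if k dvd i then real (i div k) else 0) * f $ (n - i))"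
  proof (rule sum.mono_neutral_right)
    show "(\<lambda>j. k * j) ` {1..n div k} \<subseteq> {0..n}"
      using assms by (auto simp: less_eq_div_iff_mult_less_eq mult.commute)
    show "\<forall>i\<in>{0..n} - (\<lambda>j. k * j) ` {1..n div k}. (if k dvd i then real (i div k) else 0) * f $ (n - i) = 0"
    proof
      fix i assume i: "i \<in> {0..n} - (\<lambda>j. k * j) ` {1..n div k}"
      \<comment> \<open>The only multiple of \<open>k\<close> up to \<open>n\<close> outside the
        image is 0, where the weight is 0.\<close>
      have "i = 0" if "i = k * j" for j
      proof (rule ccontr)
        assume "i \<noteq> 0"
        then have "j \<in> {1..n div k}"
          using i that assms by (auto simp: less_eq_div_iff_mult_less_eq mult.commute intro!: Suc_leI gr0I)
        then show False using i that by blast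
      qed
      then show "(if k dvd i then real (i div k) else 0) * f $ (n - i) = 0"
        by (auto elim!: dvdE)
    qed
  qed simp
  also have "\<dots> = (\<Sum>j=1..n div k. real j * f $ (n - k * j))"
    using assms by (subst sum.reindex) (auto simp: inj_on_def)
  finally show ?thesis .
qed

text \<open>Exchange the sums: a value \<open>i\<close> contributes \<open>i\<close> for each
  partition of \<open>n\<close> with at least \<open>k\<close> copies of it. Removing
  \<open>k\<close> copies turns these into all partitions of \<open>n - k * i\<close>.\<close>

lemma b_fun_eq:
  assumes "0 < k" "0 < n"
  shows "real (b_fun k (int n)) = (weight_fps k * genfun pos_mset) $ n"
proof -
  have le: "i \<in> {1..n}" if "xs \<in> partitions_of n" "i \<in> set xs" for xs i
    using that member_le_sum_list[of i xs] by (auto simp: partitions_of_def Suc_le_eq)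
  have card: "card {xs \<in> partitions_of n. k \<le> count_list xs i}
      = (if k * i \<le> n then card {M \<in> pos_mset. sum_mset M = n - k * i} else 0)"
    if "i \<in> {1..n}" for i
  proof -
    have c: "card {xs \<in> partitions_of n. k \<le> count_list xs i} = card {M \<in> pos_mset. sum_mset M = n \<and> k \<le> count M i}"
      by (rule card_partitions_of) (simp add: count_mset)
    have "{M \<in> pos_mset. k \<le> count M i} = (\<lambda>M. replicate_mset k i + M) ` pos_mset"
    proof (intro equalityI subsetI)
      fix M assume "M \<in> {M \<in> pos_mset. k \<le> count M i}"
      then have "M \<in> pos_mset" "replicate_mset k i \<subseteq># M"
        by (auto simp: count_le_replicate_mset_subset_eq)
      then have "M = replicate_mset k i + (M - replicate_mset k i)" "M - replicate_mset k i \<in> pos_mset"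
        by (auto simp: pos_mset_def dest: in_diffD)
      then show "M \<in> (\<lambda>M. replicate_mset k i + M) ` pos_mset" by blast
    qed (use that in \<open>auto simp: pos_mset_def split: if_splits\<close>)
    moreover have "genfun ((\<lambda>M. replicate_mset k i + M) ` pos_mset) = fps_X ^ (k * i) * genfun pos_mset"
      by (rule genfun_image) (auto simp: inj_on_def)
    ultimately have genfun: "genfun {M \<in> pos_mset. k \<le> count M i} = fps_X ^ (k * i) * genfun pos_mset"
      by (simp only:)
    have "real (card {xs \<in> partitions_of n. k \<le> count_list xs i}) = genfun {M \<in> pos_mset. k \<le> count M i} $ n"
      by (simp add: genfun_nth c conj_ac)
    also note genfun
    finally have "real (card {xs \<in> partitions_of n. k \<le> count_list xs i}) = (fps_X ^ (k * i) * genfun pos_mset) $ n" .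
    then show ?thesis by (auto simp: fps_X_power_mult_nth genfun_nth split: if_splits)
  qed
  have "b_fun k (int n) = (\<Sum>xs\<in>partitions_of n. \<Sum>i | i \<in> set xs \<and> k \<le> count_list xs i. i)"
    using assms by (simp add: b_fun_def)
  \<comment> \<open>As \<open>k\<close> is positive, a value counted at least \<open>k\<close> times
    is a part and so lies in \<open>{1..n}\<close>. The inner range no longer depends on
    \<open>xs\<close>, and the sums can be exchanged.\<close>
  also have "\<dots> = (\<Sum>xs\<in>partitions_of n. \<Sum>i\<in>{1..n}. if k \<le> count_list xs i then i else 0)"
  proof (rule sum.cong[OF refl])
    fix xs assume xs: "xs \<in> partitions_of n"
    have "i \<in> set xs" if "k \<le> count_list xs i" for i
      using that assms by (metis count_notin not_less)
    then have "{i. i \<in> set xs \<and> k \<le> count_list xs i} = {i \<in> {1..n}. k \<le> count_list xs i}"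
      using le[OF xs] by blast
    then show "(\<Sum>i | i \<in> set xs \<and> k \<le> count_list xs i. i) = (\<Sum>i\<in>{1..n}. if k \<le> count_list xs i then i else 0)"
      by (simp only: sum.inter_filter finite_atLeastAtMost)
  qed
  also have "\<dots> = (\<Sum>i\<in>{1..n}. \<Sum>xs\<in>partitions_of n. if k \<le> count_list xs i then i else 0)"
    by (rule sum.swap)
  also have "\<dots> = (\<Sum>i\<in>{1..n}. i * card {xs \<in> partitions_of n. k \<le> count_list xs i})"
    by (simp add: finite_partitions_of mult.commute flip: sum.inter_filter)
  also have "\<dots> = (\<Sum>i\<in>{1..n}. if k * i \<le> n then i * card {M \<in> pos_mset. sum_mset M = n - k * i} else 0)"
    by (intro sum.cong refl) (simp add: card)
  also have "\<dots> = (\<Sum>i\<in>{i \<in> {1..n}. k * i \<le> n}. i * card {M \<in> pos_mset. sum_mset M = n - k * i})"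
    by (rule sum.inter_filter[symmetric]) simp
  also have "{i \<in> {1..n}. k * i \<le> n} = {1..n div k}"
  proof -
    have "i \<le> n" if "k * i \<le> n" for i
      using assms that by (metis One_nat_def Suc_leI mult_le_mono1 mult_1 order.trans)
    then show ?thesis
      using assms by (auto simp: less_eq_div_iff_mult_less_eq mult.commute)
  qed
  finally show ?thesis
    using assms by (simp add: weight_fps_mult_nth genfun_nth)
qed

text \<open>For \<open>s > n\<close> both sides are 0. At \<open>s = n\<close> the convention that
  \<open>b_fun\<close> vanishes at 0 agrees with the constant coefficient 0 of
  \<open>weight_fps k\<close>.\<close>

lemma b_fun_shift:
  assumes "0 < k"
  shows "real (b_fun k (int n - int s)) = (fps_X ^ s * (weight_fps k * genfun pos_mset)) $ n"
proof (cases "s < n")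
  case True
  then show ?thesis
    using b_fun_eq[OF assms, of "n - s"] by (simp add: fps_X_power_mult_nth of_nat_diff)
next
  case False
  have "(weight_fps k * genfun pos_mset) $ 0 = 0" by (simp add: weight_fps_def)
  then show ?thesis
    using False by (simp add: b_fun_def fps_X_power_mult_nth)
qed

theorem theorem2p5:
  fixes k l n :: nat
  assumes "0 < k" and "0 < l" and "0 < n"
  shows "(-1) ^ (l - 1) *
           ((\<Sum>j\<in>{- (int l - 1)..int l}.
                (-1) powi j * real (b_fun k (int n - j * (3 * j - 1) div 2)))
            - (1 + (-1) ^ (of_bool (n mod k = 0) + 1)) / 2 * (real n / real k))
         = (\<Sum>j = 1..n div k. real j * real (M_fun l (n - k * j)))"
proof -
  obtain m where l: "l = Suc m" using assms(2) by (cases l) auto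
  have range: "{- (int l - 1)..int l} = {- int m..int m + 1}" by (simp add: l)
  let ?S = "\<Sum>j\<in>{- int m..int m + 1}. fps_const ((-1) powi j) * fps_X ^ pent j :: real fps"
  have "(\<Sum>j\<in>{- (int l - 1)..int l}. (-1) powi j * real (b_fun k (int n - j * (3 * j - 1) div 2)))
      = (?S * (weight_fps k * genfun pos_mset)) $ n"
    unfolding range int_pent[symmetric] b_fun_shift[OF assms(1)]
    by (simp add: sum_distrib_right fps_sum_nth mult.assoc)
  \<comment> \<open>Grouping the pentagonal sum with the partition series makes the truncated
    theorem applicable; its summand 1 leaves \<open>weight_fps k\<close>, the source of the
    correction term.\<close>
  also have "?S * (weight_fps k * genfun pos_mset) = weight_fps k * (?S * genfun pos_mset)"
    by (simp only: mult_ac)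
  also have "\<dots> = weight_fps k + fps_const ((-1) ^ m) * (weight_fps k * genfun (mex_top_heavy l))"
    unfolding truncated_pentagonal_number_theorem by (simp add: l algebra_simps)
  also have "\<dots> $ n = weight_fps k $ n + (-1) ^ m * (\<Sum>j = 1..n div k. real j * real (M_fun l (n - k * j)))"
    by (simp add: weight_fps_mult_nth[OF assms(1)] M_fun_eq[OF assms(2)])
  \<comment> \<open>The exponent of -1 is 2 if \<open>k\<close> divides \<open>n\<close> and 1
    otherwise, so the fraction is 1 or 0.\<close>
  also have "weight_fps k $ n = (1 + (-1) ^ (of_bool (n mod k = 0) + 1)) / 2 * (real n / real k)"
    by (simp add: weight_fps_def dvd_eq_mod_eq_0 real_of_nat_div)
  finally show ?thesis
    by (simp add: l flip: power_mult_distrib mult.assoc)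
qed

end
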